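(* Let $\gamma:\mathbb{S}^1\to\mathbb{R}^2$ be a regular smooth closed immersed curve with $A(\gamma)>0$, $\int_{\gamma}k\,ds=2\pi$, $K_{osc}(\gamma)<K^*$ and $I(\gamma)<\exp\big(\frac{K^*}{8\pi^2}\big)$, where $K^*=\frac{2\pi+12\pi^2-4\pi\sqrt{3\pi}\sqrt{1+3\pi}}{3}$. Then $\gamma$ is diffeomorphic to a round circle.
   Context: For a closed immersed plane curve $\gamma$ with arc-length $s$ (where $ds=|\gamma_u|\,du$) and unit normal field $\nu$: the curvature is $k=\langle\gamma_{ss},\nu\rangle$; the length is $L(\gamma)=\int|\gamma_u|\,du$; the signed enclosed area is $A(\gamma)=-\frac12\int_\gamma\langle\gamma,\nu\rangle\,ds$; the average curvature is $\overline{k}=\frac1L\int_\gamma k\,ds$; $K_{osc}(\gamma)=L(\gamma)\int_\gamma(k-\overline{k})^2\,ds$; $I(\gamma)=\frac{L(\gamma)^2}{4\pi A(\gamma)}$. *)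

theory Defs
  imports "HOL-Analysis.Analysis"
begin

text \<open>
  The plane \<open>\<real>\<^sup>2\<close> is the type \<^typ>\<open>complex\<close>, with its Euclidean norm and inner product, and
  \<open>S\<^sup>1\<close> is the unit circle \<open>sphere 0 1\<close> in it. A closed curve is a map \<open>\<gamma>\<close> on this circle (its values
  elsewhere are irrelevant); the parameter \<open>u\<close> is the angle, so \<open>\<gamma>\<close> at parameter \<open>u\<close> is \<open>\<gamma> (cis u)\<close>.
\<close>

section \<open>Smooth maps and diffeomorphisms between subsets of normed spaces\<close>

text \<open>Meant for open \<open>U\<close>: the directional derivatives of \<open>f\<close> up to order \<open>n\<close>, obtained by iterating
  the Frechet derivative, exist and are continuous on \<open>U\<close>.\<close>

primrec Ck_on :: "nat \<Rightarrow> ('a::real_normed_vector \<Rightarrow> 'b::real_normed_vector) \<Rightarrow> 'a set \<Rightarrow> bool" where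
  "Ck_on 0 f U \<longleftrightarrow> continuous_on U f"
| "Ck_on (Suc n) f U \<longleftrightarrow>
     (\<forall>x\<in>U. f differentiable (at x)) \<and> (\<forall>v. Ck_on n (\<lambda>x. frechet_derivative f (at x) v) U)"

text \<open>Smoothness on an arbitrary subset: local extendability to smooth maps on open sets. On an
  embedded submanifold such as a circle this is the intrinsic notion of smoothness.\<close>

definition smooth_map_on :: "'a::real_normed_vector set \<Rightarrow> ('a \<Rightarrow> 'b::real_normed_vector) \<Rightarrow> bool" where
  "smooth_map_on X f \<longleftrightarrow>
     (\<forall>x\<in>X. \<exists>U F. open U \<and> x \<in> U \<and> (\<forall>n. Ck_on n F U) \<and> (\<forall>y\<in>X \<inter> U. F y = f y))"

definition diffeomorphic ::
    "'a::real_normed_vector set \<Rightarrow> 'b::real_normed_vector set \<Rightarrow> bool" where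
  "diffeomorphic X Y \<longleftrightarrow>
     (\<exists>f g. homeomorphism X Y f g \<and> smooth_map_on X f \<and> smooth_map_on Y g)"

section \<open>Closed immersed plane curves\<close>

definition velocity :: "(complex \<Rightarrow> complex) \<Rightarrow> real \<Rightarrow> complex" where
  "velocity \<gamma> u = vector_derivative (\<lambda>t. \<gamma> (cis t)) (at u)"

definition smooth_closed_immersed :: "(complex \<Rightarrow> complex) \<Rightarrow> bool" where
  "smooth_closed_immersed \<gamma> \<longleftrightarrow> smooth_map_on (sphere 0 1) \<gamma> \<and> (\<forall>u. velocity \<gamma> u \<noteq> 0)"

text \<open>The normal field may be either of the two continuous choices; the signs of curvature and of
  the enclosed area depend on it.\<close>

definition unit_normal_field :: "(complex \<Rightarrow> complex) \<Rightarrow> (complex \<Rightarrow> complex) \<Rightarrow> bool" where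
  "unit_normal_field \<gamma> \<nu> \<longleftrightarrow> continuous_on (sphere 0 1) \<nu> \<and>
     (\<forall>u. norm (\<nu> (cis u)) = 1 \<and> \<nu> (cis u) \<bullet> velocity \<gamma> u = 0)"

text \<open>The derivative with respect to arc length of a function of the parameter \<open>u\<close>,
  \<open>\<partial>\<^sub>s = |\<gamma>\<^sub>u|\<^sup>-\<^sup>1 \<partial>\<^sub>u\<close>, and the integral over \<open>\<gamma>\<close>, with \<open>ds = |\<gamma>\<^sub>u| du\<close>.\<close>

definition arc_deriv :: "(complex \<Rightarrow> complex) \<Rightarrow> (real \<Rightarrow> complex) \<Rightarrow> real \<Rightarrow> complex" where
  "arc_deriv \<gamma> f u = vector_derivative f (at u) /\<^sub>R norm (velocity \<gamma> u)"

definition arc_integral :: "(complex \<Rightarrow> complex) \<Rightarrow> (real \<Rightarrow> real) \<Rightarrow> real" where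
  "arc_integral \<gamma> f = integral {0..2 * pi} (\<lambda>u. f u * norm (velocity \<gamma> u))"

definition curvature :: "(complex \<Rightarrow> complex) \<Rightarrow> (complex \<Rightarrow> complex) \<Rightarrow> real \<Rightarrow> real" where
  "curvature \<gamma> \<nu> u = arc_deriv \<gamma> (arc_deriv \<gamma> (\<lambda>t. \<gamma> (cis t))) u \<bullet> \<nu> (cis u)"

definition curve_length :: "(complex \<Rightarrow> complex) \<Rightarrow> real" where
  "curve_length \<gamma> = integral {0..2 * pi} (\<lambda>u. norm (velocity \<gamma> u))"

definition signed_area :: "(complex \<Rightarrow> complex) \<Rightarrow> (complex \<Rightarrow> complex) \<Rightarrow> real" where
  "signed_area \<gamma> \<nu> = - (1 / 2) * arc_integral \<gamma> (\<lambda>u. \<gamma> (cis u) \<bullet> \<nu> (cis u))"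

definition avg_curvature :: "(complex \<Rightarrow> complex) \<Rightarrow> (complex \<Rightarrow> complex) \<Rightarrow> real" where
  "avg_curvature \<gamma> \<nu> = 1 / curve_length \<gamma> * arc_integral \<gamma> (curvature \<gamma> \<nu>)"

definition K_osc :: "(complex \<Rightarrow> complex) \<Rightarrow> (complex \<Rightarrow> complex) \<Rightarrow> real" where
  "K_osc \<gamma> \<nu> = curve_length \<gamma> * arc_integral \<gamma> (\<lambda>u. (curvature \<gamma> \<nu> u - avg_curvature \<gamma> \<nu>)\<^sup>2)"

definition isoperimetric_ratio :: "(complex \<Rightarrow> complex) \<Rightarrow> (complex \<Rightarrow> complex) \<Rightarrow> real" where
  "isoperimetric_ratio \<gamma> \<nu> = (curve_length \<gamma>)\<^sup>2 / (4 * pi * signed_area \<gamma> \<nu>)"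

definition K_star :: real where
  "K_star = (2 * pi + 12 * pi\<^sup>2 - 4 * pi * sqrt (3 * pi) * sqrt (1 + 3 * pi)) / 3"

text \<open>The domain \<open>S\<^sup>1\<close> of any \<open>\<gamma>\<close> is trivially diffeomorphic to a round circle, so the notion
  concerns the curve in the plane: \<open>\<gamma>\<close> has no self-intersections (in particular does not traverse its
  image several times), and its image is diffeomorphic to a round circle.\<close>

definition diffeomorphic_to_round_circle :: "(complex \<Rightarrow> complex) \<Rightarrow> bool" where
  "diffeomorphic_to_round_circle \<gamma> \<longleftrightarrow> inj_on \<gamma> (sphere 0 1) \<and>
     (\<exists>c::complex. \<exists>r>0. diffeomorphic (\<gamma> ` sphere 0 1) (sphere c r))"

end

theory Submission
  imports Defs
begin

text \<open>
  Only the embeddedness of \<open>\<gamma>\<close> is a matter of curvature: an injective immersion of a circle is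
  a diffeomorphism onto its image.

  \<^bold>\<open>Embeddedness.\<close> Since the total curvature is \<open>2\<pi>\<close>, the average curvature is \<open>2\<pi>/L\<close>, that of
  a circle of length \<open>L\<close>. Let \<open>s\<close> be arc length, \<open>\<tau>\<close> the unit tangent and \<open>e(s) = exp(2\<pi>i\<sigma>s/L)\<close> the
  tangent of that circle, where \<open>\<sigma> = \<plusminus>1\<close> records on which side of \<open>\<tau>\<close> the normal lies. The quotient
  \<open>W = \<tau>/e\<close> satisfies \<open>|dW/ds| = |k - 2\<pi>/L|\<close>, so it moves by at most
  \<open>\<integral>|k - 2\<pi>/L| ds \<le> \<integral>(L (k - 2\<pi>/L)\<^sup>2 + 1/(4L)) ds = K\<^sub>o\<^sub>s\<^sub>c + 1/4\<close>, which is less than \<open>1/2\<close>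
  because \<open>K\<^sup>* < 1/4\<close>. Hence, up to one fixed rotation, \<open>\<tau>\<close> stays within \<open>1/2\<close> of \<open>e\<close>, and
  integrating over an arc of length \<open>d\<close> shows that each chord of \<open>\<gamma>\<close> differs by at most \<open>d/2\<close> from the
  corresponding chord of the circle. If \<open>\<gamma>\<close> returned to a point, then the circle's chord, of length
  \<open>(L/\<pi>) sin(\<pi>d/L)\<close>, would be at most \<open>d/2\<close> and, by the same estimate on the complementary arc, at most
  \<open>(L - d)/2\<close>; but \<open>sin x > x/2\<close> on \<open>(0, \<pi>/2]\<close>, so one of the two fails. The lemma
  \<open>inj_on_if_turning_nearly_uniform\<close> carries this out for a frame along a curve with arbitrary
  parametrization, and \<open>curve_frame\<close> provides the frame of \<open>\<gamma>\<close>.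

  \<^bold>\<open>The image.\<close> Near \<open>\<gamma>(cis t\<^sub>0)\<close> the inverse of \<open>\<gamma>\<close> has to be extended to an open set of the plane.
  The height \<open>h(t) = \<gamma>(cis t) \<bullet> v\<close> in the direction \<open>v\<close> of the velocity at \<open>t\<^sub>0\<close> has a nonzero derivative
  there, so it has a smooth local inverse \<open>g\<close> on the line, and \<open>y \<mapsto> cis (g (y \<bullet> v))\<close> is the
  extension. It takes the right values on the image of distant parts of the circle as well, because those
  stay away from \<open>\<gamma>(cis t\<^sub>0)\<close> by compactness and injectivity. Smoothness is then a matter of the chain
  rule and the one-dimensional inverse function theorem for \<^const>\<open>Ck_on\<close>.
\<close>

section \<open>A calculus of smooth maps on open sets\<close>

lemma Ck_on_cong:
  assumes "open U" "\<And>x. x \<in> U \<Longrightarrow> f x = g x" "Ck_on n f U"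
  shows "Ck_on n g U"
  using assms(2,3)
proof (induction n arbitrary: f g)
  case 0
  then show ?case by (metis Ck_on.simps(1) continuous_on_cong)
next
  case (Suc n)
  have g: "(g has_derivative frechet_derivative f (at x)) (at x)" if "x \<in> U" for x
  proof (rule has_derivative_transform_within_open[OF _ assms(1) that])
    show "(f has_derivative frechet_derivative f (at x)) (at x)"
      using Suc.prems that by (simp add: frechet_derivative_works)
  qed (use Suc.prems in auto)
  show ?case unfolding Ck_on.simps
  proof (intro conjI ballI allI)
    show "g differentiable (at x)" if "x \<in> U" for x
      using g[OF that] by (rule differentiableI)
    show "Ck_on n (\<lambda>x. frechet_derivative g (at x) v) U" for v
    proof (rule Suc.IH)
      show "frechet_derivative f (at x) v = frechet_derivative g (at x) v" if "x \<in> U" for x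
        using frechet_derivative_at[OF g[OF that]] by simp
      show "Ck_on n (\<lambda>x. frechet_derivative f (at x) v) U" using Suc.prems by simp
    qed
  qed
qed

lemma Ck_on_SucI:
  assumes "\<And>x. x \<in> U \<Longrightarrow> (f has_derivative f' x) (at x)"
    and "\<And>v. Ck_on n (\<lambda>x. f' x v) U" and "open U"
  shows "Ck_on (Suc n) f U"
  unfolding Ck_on.simps
proof (intro conjI ballI allI)
  show "f differentiable (at x)" if "x \<in> U" for x
    using assms(1)[OF that] by (rule differentiableI)
  show "Ck_on n (\<lambda>x. frechet_derivative f (at x) v) U" for v
  proof (rule Ck_on_cong[OF assms(3) _ assms(2)])
    show "f' x v = frechet_derivative f (at x) v" if "x \<in> U" for x
      using frechet_derivative_at[OF assms(1)[OF that]] by simp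
  qed
qed

lemma Ck_on_SucD:
  assumes "Ck_on (Suc n) f U"
  shows "Ck_on n f U"
  using assms
proof (induction n arbitrary: f)
  case 0
  then show ?case
    by (simp add: continuous_at_imp_continuous_on differentiable_imp_continuous_within)
qed simp

lemma Ck_on_subset:
  assumes "Ck_on n f U" "V \<subseteq> U"
  shows "Ck_on n f V"
  using assms by (induction n arbitrary: f) (auto intro: continuous_on_subset)

text \<open>Derivatives are taken at points, so smoothness is a local property.\<close>

lemma Ck_on_local:
  assumes "\<And>x. x \<in> U \<Longrightarrow> \<exists>V. open V \<and> x \<in> V \<and> Ck_on n f V"
  shows "Ck_on n f U"
  using assms
proof (induction n arbitrary: f)
  case 0
  have "isCont f x" if "x \<in> U" for x
    using 0[OF that] continuous_on_eq_continuous_at by auto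
  then show ?case by (simp add: continuous_at_imp_continuous_on)
next
  case (Suc n)
  show ?case unfolding Ck_on.simps
  proof (intro conjI ballI allI)
    show "f differentiable (at x)" if "x \<in> U" for x
      using Suc.prems[OF that] by auto
    show "Ck_on n (\<lambda>x. frechet_derivative f (at x) v) U" for v
      by (rule Suc.IH) (use Suc.prems in fastforce)
  qed
qed

lemma Ck_on_const: "open U \<Longrightarrow> Ck_on n (\<lambda>x. c) U"
proof (induction n arbitrary: c)
  case (Suc n)
  show ?case
    by (rule Ck_on_SucI[where f' = "\<lambda>x v. 0"]) (use Suc in auto)
qed simp

lemma Ck_on_bounded_linear_compose:
  assumes "bounded_linear l" "open U" "Ck_on n f U"
  shows "Ck_on n (\<lambda>x. l (f x)) U"
  using assms(3)
proof (induction n arbitrary: f)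
  case 0
  then show ?case using assms(1) by (simp add: bounded_linear.continuous_on)
next
  case (Suc n)
  show ?case
  proof (rule Ck_on_SucI[where f' = "\<lambda>x v. l (frechet_derivative f (at x) v)"])
    show "((\<lambda>x. l (f x)) has_derivative (\<lambda>v. l (frechet_derivative f (at x) v))) (at x)"
      if "x \<in> U" for x
      using Suc.prems that
      by (intro bounded_linear.has_derivative[OF assms(1)]) (simp add: frechet_derivative_works)
    show "Ck_on n (\<lambda>x. l (frechet_derivative f (at x) v)) U" for v
      using Suc by simp
  qed (use assms in auto)
qed

lemma Ck_on_bounded_linear:
  assumes "bounded_linear l" "open U"
  shows "Ck_on n l U"
proof (cases n)
  case 0
  then show ?thesis using assms by (simp add: linear_continuous_on)
next
  case (Suc m)
  show ?thesis unfolding Suc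
    by (rule Ck_on_SucI[where f' = "\<lambda>x v. l v"])
       (use assms in \<open>auto intro: bounded_linear_imp_has_derivative Ck_on_const\<close>)
qed

lemma Ck_on_add:
  assumes "open U" "Ck_on n f U" "Ck_on n g U"
  shows "Ck_on n (\<lambda>x. f x + g x) U"
  using assms(2,3)
proof (induction n arbitrary: f g)
  case 0
  then show ?case by (simp add: continuous_on_add)
next
  case (Suc n)
  show ?case
  proof (rule Ck_on_SucI
      [where f' = "\<lambda>x v. frechet_derivative f (at x) v + frechet_derivative g (at x) v"])
    show "((\<lambda>x. f x + g x) has_derivative
        (\<lambda>v. frechet_derivative f (at x) v + frechet_derivative g (at x) v)) (at x)"
      if "x \<in> U" for x
      using Suc.prems that by (intro has_derivative_add) (simp_all add: frechet_derivative_works)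
  qed (use Suc assms in auto)
qed

lemma Ck_on_sum:
  assumes "open U" "\<And>i. i \<in> I \<Longrightarrow> Ck_on n (f i) U"
  shows "Ck_on n (\<lambda>x. \<Sum>i\<in>I. f i x) U"
  using assms by (induction I rule: infinite_finite_induct) (auto intro: Ck_on_const Ck_on_add)

lemma Ck_on_bounded_bilinear:
  assumes "bounded_bilinear p" "open U" "Ck_on n f U" "Ck_on n g U"
  shows "Ck_on n (\<lambda>x. p (f x) (g x)) U"
  using assms(3,4)
proof (induction n arbitrary: f g)
  case 0
  then show ?case using assms(1) by (simp add: bounded_bilinear.continuous_on)
next
  case (Suc n)
  show ?case
  proof (rule Ck_on_SucI[where f' =
        "\<lambda>x v. p (f x) (frechet_derivative g (at x) v) + p (frechet_derivative f (at x) v) (g x)"])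
    show "((\<lambda>x. p (f x) (g x)) has_derivative (\<lambda>v. p (f x) (frechet_derivative g (at x) v)
        + p (frechet_derivative f (at x) v) (g x))) (at x)"
      if "x \<in> U" for x
      using Suc.prems that
      by (intro bounded_bilinear.FDERIV[OF assms(1)]) (simp_all add: frechet_derivative_works)
    have "Ck_on n f U" "Ck_on n g U"
      using Suc.prems by (blast intro: Ck_on_SucD)+
    then show "Ck_on n (\<lambda>x. p (f x) (frechet_derivative g (at x) v)
        + p (frechet_derivative f (at x) v) (g x)) U" for v
      using Suc by (intro Ck_on_add Suc.IH) (simp_all add: assms)
  qed (use assms in auto)
qed

text \<open>Iterated directional derivatives do not obviously compose, because the chain rule
  differentiates the outer map in a direction that moves with the point. Expanding that direction
  in a basis leaves only derivatives of the outer map in fixed directions.\<close>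

lemma Ck_on_compose:
  fixes f :: "'b::euclidean_space \<Rightarrow> 'c::real_normed_vector"
  assumes "open U" "open V" "g ` U \<subseteq> V" "Ck_on n f V" "Ck_on n g U"
  shows "Ck_on n (\<lambda>x. f (g x)) U"
  using assms(4,5)
proof (induction n arbitrary: f)
  case 0
  then show ?case using assms(3) by (auto intro: continuous_on_compose2)
next
  case (Suc n)
  let ?f' = "\<lambda>x v. \<Sum>b\<in>Basis. (frechet_derivative g (at x) v \<bullet> b) *\<^sub>R frechet_derivative f (at (g x)) b"
  show ?case
  proof (rule Ck_on_SucI[where f' = ?f'])
    show "((\<lambda>x. f (g x)) has_derivative ?f' x) (at x)" if "x \<in> U" for x
    proof -
      have f: "(f has_derivative frechet_derivative f (at (g x))) (at (g x))"
        using Suc.prems(1) that assms(3) by (auto simp: frechet_derivative_works)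
      have g: "(g has_derivative frechet_derivative g (at x)) (at x)"
        using Suc.prems(2) that by (auto simp: frechet_derivative_works)
      interpret bounded_linear "frechet_derivative f (at (g x))"
        using f by (rule has_derivative_bounded_linear)
      have "?f' x v = frechet_derivative f (at (g x)) (frechet_derivative g (at x) v)" for v
        by (subst euclidean_representation[of "frechet_derivative g (at x) v", symmetric])
           (simp only: sum scaleR)
      then show ?thesis
        using has_derivative_compose[OF g f] by (simp add: fun_eq_iff)
    qed
    have "Ck_on n g U" using Suc.prems(2) by (rule Ck_on_SucD)
    then show "Ck_on n (\<lambda>x. ?f' x v) U" for v
      using Suc.prems
      by (intro Ck_on_sum Ck_on_bounded_bilinear[OF bounded_bilinear_scaleR] assms(1)
            Ck_on_bounded_linear_compose[OF bounded_linear_inner_left] Suc.IH) simp_all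
  qed (use assms in auto)
qed

lemma Ck_on_cis: "Ck_on n cis UNIV"
proof (induction n)
  case 0
  then show ?case by (simp add: continuous_on_cis)
next
  case (Suc n)
  show ?case
  proof (rule Ck_on_SucI[where f' = "\<lambda>x v. v *\<^sub>R (\<i> * cis x)"])
    show "(cis has_derivative (\<lambda>v. v *\<^sub>R (\<i> * cis x))) (at x)" for x
      using has_derivative_cis[OF has_derivative_ident] by simp
    show "Ck_on n (\<lambda>x. v *\<^sub>R (\<i> * cis x)) UNIV" for v
      by (rule Ck_on_bounded_linear_compose[OF _ open_UNIV Suc])
         (intro bounded_linear_const_scaleR bounded_linear_const_mult bounded_linear_ident)
  qed auto
qed

text \<open>The derivative \<open>- 1 / x\<^sup>2\<close> is kept as a product of two copies of the function, so that the
  induction closes under the product rule.\<close>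

lemma Ck_on_inverse: "Ck_on n (inverse :: real \<Rightarrow> real) (- {0})"
proof (induction n)
  case 0
  then show ?case by (auto intro!: continuous_intros)
next
  case (Suc n)
  show ?case
  proof (rule Ck_on_SucI[where f' = "\<lambda>x v. (- v) * (inverse x * inverse x)"])
    show "(inverse has_derivative (\<lambda>v. - v * (inverse x * inverse x))) (at x)"
      if "x \<in> - {0}" for x :: real
      using that by (auto intro!: derivative_eq_intros)
    show "Ck_on n (\<lambda>x::real. - v * (inverse x * inverse x)) (- {0})" for v
      by (intro Ck_on_bounded_bilinear[OF bounded_bilinear_mult] Ck_on_const Suc open_Compl closed_singleton)
  qed auto
qed

lemma Ck_on_vector_derivative:
  fixes f :: "real \<Rightarrow> 'a::real_normed_vector"
  assumes "open U" "Ck_on (Suc n) f U"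
  shows "Ck_on n (\<lambda>t. vector_derivative f (at t)) U"
proof (rule Ck_on_cong[OF assms(1)])
  show "Ck_on n (\<lambda>t. frechet_derivative f (at t) 1) U"
    using assms(2) by simp
  show "frechet_derivative f (at t) 1 = vector_derivative f (at t)" if "t \<in> U" for t
    using assms(2) that by (simp add: frechet_derivative_eq_vector_derivative)
qed

lemma Ck_on_Suc_has_vector_derivative:
  fixes f :: "real \<Rightarrow> 'a::real_normed_vector"
  assumes "Ck_on (Suc n) f U" "t \<in> U"
  shows "(f has_vector_derivative vector_derivative f (at t)) (at t)"
  using assms by (simp add: vector_derivative_works[symmetric])

text \<open>The inverse \<open>g\<close> satisfies \<open>g' = 1 / (h' \<circ> g)\<close>; as the right-hand side is as smooth as \<open>g\<close>,
  the left-hand side shows that \<open>g\<close> has one more derivative, and the regularity bootstraps.\<close>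

lemma smooth_local_inverse:
  fixes h :: "real \<Rightarrow> real"
  assumes h: "\<And>n. Ck_on n h UNIV" and nz: "vector_derivative h (at t0) \<noteq> 0"
  obtains I J g where "open I" "t0 \<in> I" "open J" "h ` I = J"
    "\<And>n. Ck_on n g J" "\<And>t. t \<in> I \<Longrightarrow> g (h t) = t"
proof -
  define h' where "h' t = vector_derivative h (at t)" for t
  have der: "(h has_vector_derivative h' t) (at t)" for t
    unfolding h'_def using Ck_on_Suc_has_vector_derivative[OF h] by auto
  have h': "Ck_on n h' UNIV" for n
    unfolding h'_def using Ck_on_vector_derivative[OF open_UNIV h] .
  let ?D = "\<lambda>t. blinfun_scaleR_left (h' t)"
  have 1: "(h has_derivative blinfun_apply (?D t)) (at t)" for t
    using der[of t] by (simp add: has_vector_derivative_def)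
  have "continuous_on UNIV h'" using h'[of 0] by simp
  then have 2: "continuous_on UNIV ?D"
    using bounded_linear.continuous_on[OF bounded_linear_blinfun_scaleR_left] by blast
  have 3: "blinfun_scaleR_left (inverse (h' t0)) o\<^sub>L ?D t0 = id_blinfun"
    using nz by (intro blinfun_eqI) (simp add: h'_def)
  obtain I J g g' where IJ: "open I" "t0 \<in> I" "open J" "homeomorphism I J h g"
    and g: "\<And>y. y \<in> J \<Longrightarrow> (g has_derivative g' y) (at y)"
    and g': "\<And>y. y \<in> J \<Longrightarrow> g' y = inv (blinfun_apply (?D (g y)))"
    and bij: "\<And>y. y \<in> J \<Longrightarrow> bij (blinfun_apply (?D (g y)))"
    using inverse_function_theorem[OF open_UNIV 1 2 _ 3] by (metis UNIV_I)
  have nz': "h' (g y) \<noteq> 0" if "y \<in> J" for y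
  proof
    assume "h' (g y) = 0"
    then have "blinfun_apply (?D (g y)) 0 = blinfun_apply (?D (g y)) 1" by simp
    then show False using bij_is_inj[OF bij[OF that]] by (simp only: inj_eq zero_neq_one)
  qed
  have g'': "g' y v = v * inverse (h' (g y))" if "y \<in> J" for y v
    unfolding g'[OF that]
  proof (rule inv_f_eq[OF bij_is_inj[OF bij[OF that]]])
    show "blinfun_apply (?D (g y)) (v * inverse (h' (g y))) = v"
      using nz'[OF that] by (simp add: field_simps)
  qed
  have Ck: "Ck_on n g J" for n
  proof (induction n)
    case 0
    then show ?case using IJ(4) by (simp add: homeomorphism_def)
  next
    case (Suc n)
    show ?case
    proof (rule Ck_on_SucI[where f' = "\<lambda>y v. v * inverse (h' (g y))"])
      show "(g has_derivative (\<lambda>v. v * inverse (h' (g y)))) (at y)" if "y \<in> J" for y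
        using g[OF that] ext[of "g' y", OF g''[OF that]] by simp
      have "Ck_on n (\<lambda>y. h' (g y)) J"
        by (rule Ck_on_compose[OF IJ(3) open_UNIV subset_UNIV h' Suc])
      moreover have "(\<lambda>y. h' (g y)) ` J \<subseteq> - {0}"
        by (auto simp: nz')
      moreover have "open (- {0::real})" by auto
      ultimately have "Ck_on n (\<lambda>y. inverse (h' (g y))) J"
        using IJ(3) by (intro Ck_on_compose[where f = inverse and g = "\<lambda>y. h' (g y)", OF _ _ _ Ck_on_inverse])
      then show "Ck_on n (\<lambda>y. v * inverse (h' (g y))) J" for v
        by (rule Ck_on_bounded_linear_compose[OF bounded_linear_mult_right IJ(3)])
    qed (rule IJ(3))
  qed
  show thesis
    using that[OF IJ(1-3) homeomorphism_image1[OF IJ(4)] Ck] homeomorphism_apply1[OF IJ(4)]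
    by blast
qed

section \<open>Closed curves whose tangent turns almost uniformly\<close>

lemma indefinite_integral_has_vector_derivative_interior:
  fixes f :: "real \<Rightarrow> 'a::banach"
  assumes "continuous_on {a..b} f" "a < x" "x < b"
  shows "((\<lambda>u. integral {a..u} f) has_vector_derivative f x) (at x)"
  using integral_has_vector_derivative[OF assms(1), of x] assms(2,3)
  by (simp add: at_within_Icc_at)

lemma norm_cis_diff: "norm (cis b - cis a) = 2 * \<bar>sin ((b - a) / 2)\<bar>"
proof -
  have "cis b - cis a = cis a * (cis (b - a) - 1)"
    by (simp add: algebra_simps cis_mult)
  also have "cis (b - a) = exp (\<i> * of_real (b - a))" by (rule cis_conv_exp)
  finally show ?thesis by (simp only: norm_mult norm_cis dist_exp_i_1 mult_1)
qed

text \<open>With \<open>z = x / 2\<close> this is \<open>sin x = 2 sin z cos z > 2 z cos\<^sup>2 z\<close>, where \<open>cos\<^sup>2 z \<ge> 1/2\<close> as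
  \<open>z \<le> \<pi>/4\<close>.\<close>

lemma half_less_sin:
  fixes x :: real
  assumes "0 < x" "x \<le> pi / 2"
  shows "x / 2 < sin x"
proof -
  define z where "z = x / 2"
  have z: "0 < z" "z \<le> pi / 4" using assms by (auto simp: z_def)
  have "cos (pi / 4) \<le> cos z" using z by (intro cos_monotone_0_pi_le) auto
  then have "1 / 2 \<le> (cos z)\<^sup>2"
    using power_mono[of "cos (pi / 4)" "cos z" 2] by (simp add: cos_45 power_divide)
  moreover obtain t where t: "0 < t" "t < z" "sin z - sin 0 = (z - 0) * cos t"
    using MVT2[of 0 z sin cos] z by (auto intro: DERIV_sin)
  moreover have "cos z < cos t" using t z by (intro cos_monotone_0_pi) auto
  moreover have "0 < cos z" using z by (intro cos_gt_zero) auto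
  ultimately have "z * cos z * cos z < sin z * cos z" "z * (1 / 2) \<le> z * (cos z)\<^sup>2"
    using z by (auto intro: mult_left_mono)
  moreover have "sin x = 2 * (sin z * cos z)" using sin_double[of z] by (simp add: z_def)
  ultimately show ?thesis by (simp add: power2_eq_square z_def mult.assoc)
qed

text \<open>The curve \<open>c\<close> of length \<open>L\<close> has speed \<open>r\<close>, unit tangent \<open>\<tau>\<close> and curvature \<open>\<kappa>\<close> with respect to
  the normal \<open>\<sigma> i \<tau>\<close>. The last premise says that its tangent turns, in the mean square, almost like
  that of a circle of the same length run through once. Its chords are then close to those of that
  circle, up to a rotation. Short arcs alone would not exclude a long loop; as the chord over an arc
  is also minus the chord over the complementary one, the error is controlled by the shorter of the
  two.\<close>

lemma inj_on_if_turning_nearly_uniform: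
  fixes c \<tau> :: "real \<Rightarrow> complex" and r \<kappa> :: "real \<Rightarrow> real" and \<sigma> L :: real
  assumes "0 < p"
    and c: "\<And>u. (c has_vector_derivative r u *\<^sub>R \<tau> u) (at u)"
    and \<tau>: "\<And>u. (\<tau> has_vector_derivative (\<sigma> * \<kappa> u * r u) *\<^sub>R (\<i> * \<tau> u)) (at u)"
    and unit: "\<And>u. norm (\<tau> u) = 1" and \<sigma>: "\<sigma> = 1 \<or> \<sigma> = - 1"
    and pos: "\<And>u. 0 < r u"
    and cont: "continuous_on UNIV r" "continuous_on UNIV \<kappa>"
    and closed: "c p = c 0" "\<tau> p = \<tau> 0"
    and L: "L = integral {0..p} r"
    and osc: "L * integral {0..p} (\<lambda>u. (\<kappa> u - 2 * pi / L)\<^sup>2 * r u) < 1 / 4"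
  shows "inj_on c {0..<p}"
proof -
  have cont_p: "continuous_on {0..p} r" "continuous_on {0..p} \<kappa>"
    using cont by (auto intro: continuous_on_subset)
  have contc: "continuous_on A c" "continuous_on A \<tau>" for A
    using c \<tau> by (auto intro!: continuous_at_imp_continuous_on has_vector_derivative_continuous)

  \<comment> \<open>Arc length. It is differentiable at interior points only, which is all that
    the mean value estimates below ask for.\<close>
  define s where "s u = integral {0..u} r" for u
  have s': "(s has_vector_derivative r u) (at u)" if "0 < u" "u < p" for u
    unfolding s_def using indefinite_integral_has_vector_derivative_interior[OF cont_p(1) that] .
  have s_cont: "continuous_on {0..p} s"
    unfolding s_def by (intro indefinite_integral_continuous_1 integrable_continuous_interval cont_p)
  have s_mono: "s a < s b" if "0 \<le> a" "a < b" "b \<le> p" for a b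
  proof (rule DERIV_pos_imp_increasing_open[OF that(2)])
    show "\<exists>y. (s has_real_derivative y) (at x) \<and> 0 < y" if "a < x" "x < b" for x
      using s'[of x] that \<open>0 \<le> a\<close> \<open>b \<le> p\<close> pos
      by (auto simp: has_real_derivative_iff_has_vector_derivative)
    show "continuous_on {a..b} s"
      using s_cont that by (auto intro: continuous_on_subset)
  qed
  have s0: "s 0 = 0" and sp: "s p = L" by (simp_all add: s_def L)
  have L_pos: "0 < L" using s_mono[of 0 p] \<open>0 < p\<close> s0 sp by simp

  \<comment> \<open>The tangent of the comparison circle, and the curve's tangent relative to it.\<close>
  define e where "e u = cis (2 * pi * \<sigma> * s u / L)" for u
  have e': "(e has_vector_derivative (2 * pi * \<sigma> * r u / L) *\<^sub>R (\<i> * e u)) (at u)"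
    if "0 < u" "u < p" for u
  proof -
    have "((\<lambda>u. 2 * pi * \<sigma> * s u / L) has_derivative (\<lambda>v. v * (2 * pi * \<sigma> * r u / L))) (at u)"
      using s'[OF that, unfolded has_vector_derivative_def] L_pos
      by (auto intro!: derivative_eq_intros)
    then show ?thesis
      unfolding e_def has_vector_derivative_def
      by (rule has_derivative_eq_rhs[OF has_derivative_cis]) (simp add: fun_eq_iff)
  qed
  have e_cont: "continuous_on {0..p} e"
    unfolding e_def using L_pos by (intro continuous_intros s_cont) auto
  have e_unit: "e u * cnj (e u) = 1" for u
    by (simp add: e_def cis_cnj cis_mult)
  have e_closed: "e p = e 0"
    using \<sigma> L_pos by (auto simp: e_def s0 sp complex_eq_iff)

  define W where "W u = \<tau> u * cnj (e u)" for u
  have W': "(W has_vector_derivative (\<sigma> * (\<kappa> u - 2 * pi / L) * r u) *\<^sub>R (\<i> * W u)) (at u)"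
    if "0 < u" "u < p" for u
    unfolding W_def
    by (rule has_vector_derivative_eq_rhs, rule has_vector_derivative_mult[OF \<tau>],
        rule has_vector_derivative_cnj[OF e'[OF that]])
       (simp add: scaleR_conv_of_real algebra_simps diff_divide_distrib)
  have W_cont: "continuous_on {0..p} W"
    unfolding W_def by (intro continuous_intros contc e_cont)
  have W_norm: "norm (W u) = 1" for u
    by (simp add: W_def norm_mult unit e_def)

  \<comment> \<open>\<open>Q\<close> dominates the variation of \<open>W\<close>. The weight \<open>L\<close> of the square makes its total
    scale-invariant, and among the inequalities \<open>|y| \<le> \<lambda>Ly\<^sup>2 + 1/(4\<lambda>L)\<close> the choice \<open>\<lambda> = 1\<close> is optimal
    when the oscillation is \<open>1/4\<close>.\<close>
  define q where "q u = (L * (\<kappa> u - 2 * pi / L)\<^sup>2 + 1 / (4 * L)) * r u" for u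
  define Q where "Q u = integral {0..u} q" for u
  have q_cont: "continuous_on {0..p} q"
    unfolding q_def by (intro continuous_intros cont_p)
  have Q': "(Q has_vector_derivative q u) (at u)" if "0 < u" "u < p" for u
    unfolding Q_def using indefinite_integral_has_vector_derivative_interior[OF q_cont that] .
  have Q_cont: "continuous_on {0..p} Q"
    unfolding Q_def by (intro indefinite_integral_continuous_1 integrable_continuous_interval q_cont)
  have q_nonneg: "0 \<le> q u" for u
    using L_pos pos[of u] by (simp add: q_def)
  have Q_mono: "Q a \<le> Q b" if "0 \<le> a" "a \<le> b" "b \<le> p" for a b
  proof (rule DERIV_nonneg_imp_increasing_open[OF that(2)])
    show "\<exists>y. (Q has_real_derivative y) (at x) \<and> 0 \<le> y" if "a < x" "x < b" for x
      using Q'[of x] that \<open>0 \<le> a\<close> \<open>b \<le> p\<close> q_nonneg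
      by (auto simp: has_real_derivative_iff_has_vector_derivative)
    show "continuous_on {a..b} Q"
      using Q_cont that by (auto intro: continuous_on_subset)
  qed
  have int: "(\<lambda>u. (\<kappa> u - 2 * pi / L)\<^sup>2 * r u) integrable_on {0..p}" "r integrable_on {0..p}"
    using cont_p by (auto intro!: integrable_continuous_interval continuous_intros)
  have "Q p = integral {0..p} (\<lambda>u. L * ((\<kappa> u - 2 * pi / L)\<^sup>2 * r u) + 1 / (4 * L) * r u)"
    unfolding Q_def q_def by (simp add: algebra_simps)
  also have "\<dots> = L * integral {0..p} (\<lambda>u. (\<kappa> u - 2 * pi / L)\<^sup>2 * r u) + 1 / (4 * L) * L"
    using int
    by (subst integral_add) (simp_all only: integrable_on_mult_right integral_mult_right L)
  finally have Qp: "Q p < 1 / 2" using osc L_pos by simp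
  have "Q 0 = 0" by (simp add: Q_def)

  have W_bound': "norm (W b - W a) \<le> 1 / 2" if "0 \<le> a" "a < b" "b \<le> p" for a b
  proof -
    have "norm (W b - W a) \<le> Q b - Q a"
    proof (rule differentiable_bound_general[OF that(2)])
      show "continuous_on {a..b} W" "continuous_on {a..b} Q"
        using W_cont Q_cont that by (auto intro: continuous_on_subset)
      show "(W has_vector_derivative (\<sigma> * (\<kappa> x - 2 * pi / L) * r x) *\<^sub>R (\<i> * W x)) (at x)"
        "(Q has_vector_derivative q x) (at x)" if "a < x" "x < b" for x
        using that \<open>0 \<le> a\<close> \<open>b \<le> p\<close> by (auto intro: W' Q')
      show "norm ((\<sigma> * (\<kappa> x - 2 * pi / L) * r x) *\<^sub>R (\<i> * W x)) \<le> q x" for x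
      proof -
        have am_gm: "\<bar>y\<bar> \<le> L * y\<^sup>2 + 1 / (4 * L)" for y
        proof -
          have "0 \<le> L * (\<bar>y\<bar> - 1 / (2 * L))\<^sup>2" using L_pos by simp
          also have "\<dots> = L * y\<^sup>2 + 1 / (4 * L) - \<bar>y\<bar>"
            using L_pos by (simp add: power2_eq_square field_simps abs_mult_self_eq)
          finally show ?thesis by simp
        qed
        have "norm ((\<sigma> * (\<kappa> x - 2 * pi / L) * r x) *\<^sub>R (\<i> * W x)) = \<bar>\<kappa> x - 2 * pi / L\<bar> * r x"
          using \<sigma> pos[of x] by (auto simp: norm_mult W_norm abs_mult)
        also have "\<dots> \<le> q x"
          unfolding q_def using pos[of x] by (intro mult_right_mono am_gm) auto
        finally show ?thesis .
      qed
    qed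
    also have "\<dots> \<le> 1 / 2"
      using Q_mono[of 0 a] Q_mono[of b p] that Qp \<open>Q 0 = 0\<close> by simp
    finally show ?thesis .
  qed
  have W_bound: "norm (W b - W a) \<le> 1 / 2" if "a \<in> {0..p}" "b \<in> {0..p}" for a b
    using W_bound'[of a b] W_bound'[of b a] that
    by (cases a b rule: linorder_cases) (auto simp: norm_minus_commute)

  show ?thesis
  proof (rule linorder_inj_onI)
    fix a b assume ab: "a < b" "a \<in> {0..<p}" "b \<in> {0..<p}"
    show "c a \<noteq> c b"
    proof
      assume eq: "c a = c b"
      \<comment> \<open>\<open>E\<close> is the comparison circle; \<open>D\<close> is the difference of the two curves, after the
        circle has been rotated to have the same tangent at the parameter \<open>a\<close>.\<close>
      define E where "E u = (L / (2 * pi * \<sigma>)) *\<^sub>R (- \<i> * e u)" for u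
      define D where "D u = c u - W a * E u" for u
      have E': "(E has_vector_derivative r u *\<^sub>R e u) (at u)" if "0 < u" "u < p" for u
        unfolding E_def
        by (rule has_vector_derivative_eq_rhs, (rule derivative_intros e'[OF that])+)
           (use \<sigma> L_pos in \<open>auto simp: scaleR_conv_of_real algebra_simps\<close>)
      have D': "(D has_vector_derivative r u *\<^sub>R (e u * (W u - W a))) (at u)"
        if "0 < u" "u < p" for u
        unfolding D_def
        by (rule has_vector_derivative_eq_rhs, (rule derivative_intros c E'[OF that])+)
           (use e_unit[of u] in \<open>simp add: W_def scaleR_conv_of_real algebra_simps\<close>)
      have D_cont: "continuous_on {0..p} D"
        unfolding D_def E_def by (intro continuous_intros contc e_cont)
      have D_closed: "D p = D 0" by (simp add: D_def E_def closed e_closed)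
      have D_bound: "norm (D v - D u) \<le> s v / 2 - s u / 2" if "0 \<le> u" "u \<le> v" "v \<le> p" for u v
      proof (cases "u = v")
        case False
        then have "u < v" using that by simp
        then show ?thesis
        proof (rule differentiable_bound_general)
          show "continuous_on {u..v} D"
            using D_cont that by (auto intro: continuous_on_subset)
          have "continuous_on {u..v} s"
            using s_cont that by (auto intro: continuous_on_subset)
          then show "continuous_on {u..v} (\<lambda>x. s x / 2)" by (auto intro: continuous_intros)
          fix x assume x: "u < x" "x < v"
          show "(D has_vector_derivative r x *\<^sub>R (e x * (W x - W a))) (at x)"
            using x that by (intro D') auto
          show "((\<lambda>x. s x / 2) has_vector_derivative r x / 2) (at x)"
            using x that s'[of x] by (auto intro: derivative_intros)
          have "norm (W x - W a) \<le> 1 / 2"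
            using x that ab by (intro W_bound) auto
          then show "norm (r x *\<^sub>R (e x * (W x - W a))) \<le> r x / 2"
            using pos[of x] by (simp add: norm_mult e_def)
        qed
      qed simp
      define x where "x = pi * (s b - s a) / L"
      have s_ab: "0 \<le> s a" "s a < s b" "s b < L"
        using s_mono[of a b] s_mono[of 0 a] s_mono[of b p] ab s0 sp by (cases "a = 0"; auto)+
      have "\<bar>sin x\<bar> * (L / pi) = norm (D b - D a)"
      proof -
        have "D b - D a = - (W a * (L / (2 * pi * \<sigma>)) *\<^sub>R (- \<i> * (e b - e a)))"
          using eq by (simp add: D_def E_def algebra_simps)
        then have "norm (D b - D a) = L / (2 * pi) * norm (e b - e a)"
          using \<sigma> L_pos by (auto simp: norm_mult W_norm)
        also have "norm (e b - e a) = 2 * \<bar>sin (\<sigma> * x)\<bar>"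
          unfolding e_def norm_cis_diff x_def
          by (simp add: diff_divide_distrib algebra_simps)
        also have "\<bar>sin (\<sigma> * x)\<bar> = \<bar>sin x\<bar>" using \<sigma> by auto
        finally show ?thesis by simp
      qed
      then have sin_x: "\<bar>sin x\<bar> = norm (D b - D a) * (pi / L)"
        using L_pos by (simp add: field_simps)
      have bound_ab: "norm (D b - D a) \<le> (s b - s a) / 2"
        using D_bound[of a b] ab by (simp add: diff_divide_distrib)
      have bound_ba: "norm (D b - D a) \<le> (L - (s b - s a)) / 2"
      proof -
        have "norm (D b - D a) \<le> norm (D p - D b) + norm (D a - D 0)"
          using norm_triangle_ineq4[of "D p - D b" "- (D a - D 0)"]
          by (simp add: D_closed norm_minus_commute)
        also have "\<dots> \<le> (L - (s b - s a)) / 2"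
          using D_bound[of b p] D_bound[of 0 a] ab by (simp add: s0 sp diff_divide_distrib)
        finally show ?thesis .
      qed
      have "0 \<le> pi / L" using L_pos by simp
      from mult_right_mono[OF bound_ab this] mult_right_mono[OF bound_ba this]
      have "\<bar>sin x\<bar> \<le> x / 2" "\<bar>sin x\<bar> \<le> (pi - x) / 2"
        using L_pos unfolding sin_x by (simp_all add: x_def field_simps)
      moreover have "0 < x" using s_ab L_pos by (simp add: x_def)
      moreover have "pi * (s b - s a) < pi * L" using s_ab by simp
      then have "x < pi" using L_pos by (simp add: x_def divide_less_eq)
      ultimately show False
        using half_less_sin[of x] half_less_sin[of "pi - x"] by (cases "x \<le> pi / 2") auto
    qed
  qed auto
qed

text \<open>With \<open>x = 3\<pi>\<close> the last term of \<open>3 K\<^sup>*\<close> is \<open>4\<pi>\<close> times \<open>\<surd>(x\<^sup>2 + x)\<close>, whose expansion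
  \<open>x + 1/2 - 1/(8x) + \<dots>\<close> cancels the other two up to \<open>1/6\<close>; so in fact \<open>K\<^sup>* \<le> 1/18\<close>.\<close>

lemma K_star_less: "K_star < 1 / 4"
proof -
  define x where "x = 3 * pi"
  have x: "9 \<le> x" using pi_gt3 by (simp add: x_def)
  have "x + 1 / 2 - 1 / (8 * x) \<le> sqrt (x * (1 + x))"
  proof (rule real_le_rsqrt)
    have "(x + 1 / 2 - 1 / (8 * x))\<^sup>2 = x * (1 + x) - (8 * x - 1) / (64 * x\<^sup>2)"
      using x by (simp add: power2_eq_square field_simps)
    also have "\<dots> \<le> x * (1 + x)" using x by simp
    finally show "(x + 1 / 2 - 1 / (8 * x))\<^sup>2 \<le> x * (1 + x)" .
  qed
  then have "4 * pi * (x + 1 / 2 - 1 / (8 * x)) \<le> 4 * pi * sqrt (x * (1 + x))"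
    by (intro mult_left_mono) auto
  moreover have "4 * pi * (x + 1 / 2 - 1 / (8 * x)) = 12 * pi\<^sup>2 + 2 * pi - 1 / 6"
    by (simp add: x_def field_simps power2_eq_square)
  moreover have "4 * pi * sqrt (x * (1 + x)) = 4 * pi * sqrt (3 * pi) * sqrt (1 + 3 * pi)"
    by (simp only: x_def real_sqrt_mult mult.assoc)
  ultimately have "12 * pi\<^sup>2 + 2 * pi - 1 / 6 \<le> 4 * pi * sqrt (3 * pi) * sqrt (1 + 3 * pi)"
    by (simp only:)
  then have "K_star \<le> (1 / 6) / 3"
    unfolding K_star_def by (intro divide_right_mono) simp_all
  then show ?thesis by simp
qed

section \<open>The curve in its angular parametrization\<close>

lemma smooth_map_on_circle_angular:
  assumes "smooth_map_on (sphere 0 1) \<gamma>"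
  shows "Ck_on n (\<lambda>t. \<gamma> (cis t)) UNIV"
proof (rule Ck_on_local)
  fix t :: real
  have "cis t \<in> sphere 0 1" by simp
  then obtain U F where U: "open U" "cis t \<in> U" "\<And>n. Ck_on n F U"
    "\<And>z. z \<in> sphere 0 1 \<inter> U \<Longrightarrow> F z = \<gamma> z"
    using assms unfolding smooth_map_on_def by meson
  let ?V = "cis -` U"
  have V: "open ?V"
    using U(1) by (intro open_vimage continuous_on_cis continuous_on_id)
  have "Ck_on n (\<lambda>t. F (cis t)) ?V"
    by (rule Ck_on_compose[OF V U(1) _ U(3) Ck_on_subset[OF Ck_on_cis]]) auto
  then have "Ck_on n (\<lambda>t. \<gamma> (cis t)) ?V"
    by (rule Ck_on_cong[OF V, rotated]) (use U in auto)
  then show "\<exists>V. open V \<and> t \<in> V \<and> Ck_on n (\<lambda>t. \<gamma> (cis t)) V"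
    using V U(2) by blast
qed

lemma continuous_on_smooth_map_on:
  assumes "smooth_map_on X f"
  shows "continuous_on X f"
proof (rule continuous_on_eq_continuous_within[THEN iffD2, rule_format])
  fix x assume x: "x \<in> X"
  then obtain U F where U: "open U" "x \<in> U" "\<And>n. Ck_on n F U"
    "\<And>y. y \<in> X \<inter> U \<Longrightarrow> F y = f y"
    using assms unfolding smooth_map_on_def by meson
  have "continuous_on U F" using U(3)[of 0] by simp
  then have "isCont F x" using U continuous_on_eq_continuous_at by blast
  then have "continuous (at x within X) F" by (rule continuous_at_imp_continuous_at_within)
  moreover obtain d where "d > 0" "ball x d \<subseteq> U" using U openE by blast
  moreover have "F x' = f x'" if "x' \<in> X" "dist x' x < d" for x'
    using that U(4) \<open>ball x d \<subseteq> U\<close> by (auto simp: dist_commute subset_iff)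
  ultimately show "continuous (at x within X) f"
    using continuous_transform_within[OF _ \<open>d > 0\<close> x] by blast
qed

text \<open>Locally \<open>f\<close> is recovered from the orthogonal projection to a tangent line, which is defined on
  the whole plane. The continuity of \<open>f\<close> is what keeps the other branches of the curve, on which this
  recipe gives wrong values, out of a small neighbourhood.\<close>

lemma smooth_inverse_on_image:
  assumes "smooth_closed_immersed \<gamma>" and f: "continuous_on (\<gamma> ` sphere 0 1) f"
    and inv: "\<And>z. z \<in> sphere 0 1 \<Longrightarrow> f (\<gamma> z) = z"
  shows "smooth_map_on (\<gamma> ` sphere 0 1) f"
  unfolding smooth_map_on_def
proof
  let ?S = "sphere 0 1 :: complex set"
  fix x assume x: "x \<in> \<gamma> ` ?S"
  define c where "c = (\<lambda>t. \<gamma> (cis t))"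
  have Ck_c: "Ck_on n c UNIV" for n
    unfolding c_def using assms(1)
    by (intro smooth_map_on_circle_angular) (simp add: smooth_closed_immersed_def)
  obtain z where z: "z \<in> ?S" "x = \<gamma> z" using x by blast
  define t0 where "t0 = Arg z"
  have z_cis: "z = cis t0"
    using z(1) by (subst t0_def, subst cis_Arg) (auto simp: sgn_eq)
  define v where "v = velocity \<gamma> t0"
  define l where "l w = w \<bullet> v" for w
  have l: "bounded_linear l"
    unfolding l_def by (rule bounded_linear_inner_left)
  define h where "h t = l (c t)" for t
  have Ck_h: "Ck_on n h UNIV" for n
    unfolding h_def by (intro Ck_on_bounded_linear_compose[OF l open_UNIV] Ck_c)
  have "(c has_vector_derivative v) (at t0)"
    unfolding v_def velocity_def c_def[symmetric]
    using Ck_on_Suc_has_vector_derivative[OF Ck_c] by blast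
  then have "vector_derivative h (at t0) = v \<bullet> v"
    unfolding h_def by (intro vector_derivative_at) 
      (use bounded_linear.has_vector_derivative[OF l] in \<open>simp add: l_def\<close>)
  moreover have "v \<noteq> 0"
    using assms(1) by (simp add: smooth_closed_immersed_def v_def)
  ultimately have nz: "vector_derivative h (at t0) \<noteq> 0" by simp
  obtain I J g where IJ: "open I" "t0 \<in> I" "open J" "h ` I = J"
    and g: "\<And>n. Ck_on n g J" "\<And>t. t \<in> I \<Longrightarrow> g (h t) = t"
    by (rule smooth_local_inverse[OF Ck_h nz]) (rule that)
  \<comment> \<open>An angle function that is continuous at \<open>z\<close>, its cut being the ray through \<open>- z\<close>.\<close>
  define \<alpha> where "\<alpha> w = t0 + Arg (w * cnj z)" for w
  have cis_\<alpha>: "cis (\<alpha> w) = w" if "w \<in> ?S" for w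
  proof -
    have "cis (Arg (w * cnj z)) = w * cnj z"
      using that z(1) by (subst cis_Arg) (auto simp: norm_mult sgn_eq)
    then have "cis (\<alpha> w) = z * (w * cnj z)" by (simp only: \<alpha>_def cis_mult[symmetric] z_cis[symmetric])
    also have "\<dots> = w * (z * cnj z)" by (simp only: ac_simps)
    also have "\<dots> = w" by (simp add: z_cis cis_cnj cis_mult)
    finally show ?thesis .
  qed
  have "z * cnj z = 1" by (simp add: z_cis cis_cnj cis_mult)
  then have "isCont Arg (z * cnj z)" by (intro continuous_at_Arg) simp
  then have "isCont (\<lambda>w. Arg (w * cnj z)) z"
    by (rule isCont_o2[rotated]) (intro continuous_intros)
  then have "isCont \<alpha> z" unfolding \<alpha>_def by (intro continuous_add continuous_const)
  moreover have "f x = z" using inv z by simp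
  moreover have "\<alpha> z = t0" using \<open>z * cnj z = 1\<close> by (simp add: \<alpha>_def)
  moreover have "continuous (at x within \<gamma> ` ?S) f"
    using f x unfolding continuous_on_eq_continuous_within by blast
  ultimately have "((\<lambda>y. \<alpha> (f y)) \<longlongrightarrow> t0) (at x within \<gamma> ` ?S)"
    using isCont_tendsto_compose[of z \<alpha> f] by (simp add: continuous_within)
  then have "\<forall>\<^sub>F y in at x within \<gamma> ` ?S. \<alpha> (f y) \<in> I"
    using IJ by (auto dest: topological_tendstoD)
  then obtain U0 where U0: "open U0" "x \<in> U0"
    and "\<And>y. y \<in> U0 \<Longrightarrow> y \<noteq> x \<Longrightarrow> y \<in> \<gamma> ` ?S \<Longrightarrow> \<alpha> (f y) \<in> I"
    unfolding eventually_at_topological by blast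
  then have near: "\<alpha> (f y) \<in> I" if "y \<in> U0" "y \<in> \<gamma> ` ?S" for y
    using that \<open>f x = z\<close> \<open>\<alpha> z = t0\<close> IJ(2) by (cases "y = x") auto
  define U where "U = U0 \<inter> l -` J"
  have "open (l -` J)"
    using IJ(3) l by (intro open_vimage linear_continuous_on)
  then have U: "open U" using U0 by (simp add: U_def open_Int)
  have x_U: "x \<in> U"
    using U0 IJ by (auto simp: U_def h_def c_def z z_cis)
  have smooth: "Ck_on n (\<lambda>y. cis (g (l y))) U" for n
  proof -
    have "Ck_on n (\<lambda>y. g (l y)) U"
      by (rule Ck_on_compose[OF U IJ(3) _ g(1) Ck_on_bounded_linear[OF l U]]) (auto simp: U_def)
    then show ?thesis
      by (rule Ck_on_compose[OF U open_UNIV subset_UNIV Ck_on_cis])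
  qed
  have inverts: "cis (g (l y)) = f y" if y: "y \<in> \<gamma> ` ?S \<inter> U" for y
  proof -
    obtain w where w: "w \<in> ?S" "y = \<gamma> w" using y by blast
    have "f y = w" using w inv by simp
    then have "\<alpha> w \<in> I" using near[of y] y by (simp add: U_def)
    moreover have "l y = h (\<alpha> w)" by (simp add: h_def c_def cis_\<alpha>[OF w(1)] w(2))
    ultimately show ?thesis using g(2) cis_\<alpha>[OF w(1)] \<open>f y = w\<close> by simp
  qed
  show "\<exists>U F. open U \<and> x \<in> U \<and> (\<forall>n. Ck_on n F U) \<and> (\<forall>y\<in>\<gamma> ` ?S \<inter> U. F y = f y)"
    by (intro exI conjI allI ballI) (rule U x_U smooth inverts; assumption)+
qed

lemma embedded_curve_diffeomorphic_to_round_circle: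
  assumes "smooth_closed_immersed \<gamma>" "inj_on \<gamma> (sphere 0 1)"
  shows "diffeomorphic_to_round_circle \<gamma>"
proof -
  have smooth: "smooth_map_on (sphere 0 1) \<gamma>"
    using assms(1) by (simp add: smooth_closed_immersed_def)
  then obtain f where f: "homeomorphism (sphere 0 1) (\<gamma> ` sphere 0 1) \<gamma> f"
    using homeomorphism_compact[OF compact_sphere continuous_on_smooth_map_on refl assms(2)] by blast
  have "smooth_map_on (\<gamma> ` sphere 0 1) f"
    by (rule smooth_inverse_on_image[OF assms(1) homeomorphism_cont2[OF f] homeomorphism_apply1[OF f]])
  with smooth homeomorphism_symD[OF f] have "diffeomorphic (\<gamma> ` sphere 0 1) (sphere (0::complex) 1)"
    unfolding diffeomorphic_def by (intro exI conjI)
  then show ?thesis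
    unfolding diffeomorphic_to_round_circle_def
    by (intro conjI assms(2) exI[of _ "0::complex"] exI[of _ "1::real"]) simp_all
qed

lemma inj_on_circle_if_inj_on_angle:
  assumes "inj_on (\<lambda>t. \<gamma> (cis t)) {0..<2 * pi}"
  shows "inj_on \<gamma> (sphere 0 1)"
proof (rule inj_onI)
  fix z w :: complex assume zw: "z \<in> sphere 0 1" "w \<in> sphere 0 1" "\<gamma> z = \<gamma> w"
  have "\<exists>t\<in>{0..<2 * pi}. z = cis t" if "z \<in> sphere 0 1" for z
    using that Arg2pi[of z] by (intro bexI[of _ "Arg2pi z"]) (auto simp: cis_conv_exp is_Arg_def)
  then show "z = w" using zw assms by (metis inj_onD)
qed

lemma orthogonal_unit_decomposition:
  fixes z t :: complex
  assumes "norm t = 1" "z \<bullet> t = 0"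
  shows "z = (z \<bullet> (\<i> * t)) *\<^sub>R (\<i> * t)"
proof -
  have t: "Re t * Re t + Im t * Im t = 1"
    using assms(1) by (simp add: cmod_def power2_eq_square)
  have z: "Re z * Re t + Im z * Im t = 0"
    using assms(2) by (simp add: inner_complex_def)
  show ?thesis
  proof (rule complex_eqI)
    have "Re z = (- Re z * Im t + Im z * Re t) * (- Im t)" using t z by algebra
    then show "Re z = Re ((z \<bullet> (\<i> * t)) *\<^sub>R (\<i> * t))" by (simp add: inner_complex_def)
    have "Im z = (- Re z * Im t + Im z * Re t) * Re t" using t z by algebra
    then show "Im z = Im ((z \<bullet> (\<i> * t)) *\<^sub>R (\<i> * t))" by (simp add: inner_complex_def)
  qed
qed

text \<open>The sign by which the normal differs from the rotated tangent is continuous in the parameter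
  and takes only two values, so it is constant.\<close>

lemma unit_normal_field_eq_rotated_tangent:
  assumes "smooth_closed_immersed \<gamma>" "unit_normal_field \<gamma> \<nu>"
    and \<tau>: "continuous_on UNIV \<tau>" "\<And>u. velocity \<gamma> u = norm (velocity \<gamma> u) *\<^sub>R \<tau> u"
  obtains \<sigma> :: real where "\<sigma> = 1 \<or> \<sigma> = - 1" "\<And>u. \<nu> (cis u) = \<sigma> *\<^sub>R (\<i> * \<tau> u)"
proof -
  have nz: "norm (velocity \<gamma> u) > 0" for u
    using assms(1) by (simp add: smooth_closed_immersed_def)
  have unit: "norm (\<tau> u) = 1" for u
    using arg_cong[OF \<tau>(2)[of u], of norm] nz[of u] by simp
  have normal: "norm (\<nu> (cis u)) = 1" "\<nu> (cis u) \<bullet> \<tau> u = 0" for u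
  proof -
    show "norm (\<nu> (cis u)) = 1" using assms(2) by (simp add: unit_normal_field_def)
    have "\<nu> (cis u) \<bullet> (norm (velocity \<gamma> u) *\<^sub>R \<tau> u) = 0"
      using assms(2) \<tau>(2)[of u] by (simp add: unit_normal_field_def)
    then show "\<nu> (cis u) \<bullet> \<tau> u = 0" using nz[of u] by simp
  qed
  define s where "s u = \<nu> (cis u) \<bullet> (\<i> * \<tau> u)" for u
  have \<nu>: "\<nu> (cis u) = s u *\<^sub>R (\<i> * \<tau> u)" for u
    unfolding s_def using unit normal(2) by (rule orthogonal_unit_decomposition)
  have s: "s u = 1 \<or> s u = - 1" for u
    using arg_cong[OF \<nu>[of u], of norm] normal(1)[of u] unit[of u] by (auto simp: norm_mult)
  have "continuous_on UNIV (\<lambda>u. \<nu> (cis u))"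
    using assms(2) unfolding unit_normal_field_def
    by (intro continuous_on_compose2[of "sphere 0 1" \<nu> UNIV cis] continuous_intros) auto
  then have "continuous_on UNIV s"
    unfolding s_def by (intro continuous_intros \<tau>(1))
  moreover have "finite (range s)"
    using s by (intro finite_subset[of "range s" "{1, - 1}"]) auto
  ultimately have "s constant_on UNIV"
    by (intro continuous_finite_range_constant) auto
  then obtain \<sigma> where "\<And>u. s u = \<sigma>" unfolding constant_on_def by auto
  then show thesis using that[of \<sigma>] s \<nu> by metis
qed

text \<open>The Frenet equations in the angular parameter, for either choice of the normal: \<open>\<tau>'\<close> is orthogonal
  to the unit vector \<open>\<tau>\<close>, hence a multiple of the normal, and the multiple is by definition the curvature
  times the speed.\<close>

lemma curve_frame:
  assumes \<gamma>: "smooth_closed_immersed \<gamma>" and \<nu>: "unit_normal_field \<gamma> \<nu>"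
  obtains \<tau> \<sigma> where
    "\<And>u. ((\<lambda>t. \<gamma> (cis t)) has_vector_derivative norm (velocity \<gamma> u) *\<^sub>R \<tau> u) (at u)"
    "\<And>u. (\<tau> has_vector_derivative (\<sigma> * curvature \<gamma> \<nu> u * norm (velocity \<gamma> u)) *\<^sub>R (\<i> * \<tau> u)) (at u)"
    "\<And>u. norm (\<tau> u) = 1" "\<sigma> = 1 \<or> \<sigma> = - 1" "\<tau> (2 * pi) = \<tau> 0"
    "continuous_on UNIV (\<lambda>u. norm (velocity \<gamma> u))" "continuous_on UNIV (curvature \<gamma> \<nu>)"
proof -
  define c where "c = (\<lambda>t. \<gamma> (cis t))"
  have Ck_c: "Ck_on n c UNIV" for n
    unfolding c_def using \<gamma>
    by (intro smooth_map_on_circle_angular) (simp add: smooth_closed_immersed_def)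
  define v where "v = velocity \<gamma>"
  have v: "v = (\<lambda>t. vector_derivative c (at t))"
    by (simp add: v_def velocity_def c_def fun_eq_iff)
  have Ck_v: "Ck_on n v UNIV" for n
    unfolding v using Ck_on_vector_derivative[OF open_UNIV Ck_c] .
  define a where "a t = vector_derivative v (at t)" for t
  have a_cont: "continuous_on UNIV a"
    using Ck_on_vector_derivative[OF open_UNIV Ck_v, of 0] by (simp add: a_def)
  have v_cont: "continuous_on UNIV v" using Ck_v[of 0] by simp
  have c': "(c has_vector_derivative v t) (at t)" for t
    unfolding v using Ck_on_Suc_has_vector_derivative[OF Ck_c] by blast
  have v': "(v has_vector_derivative a t) (at t)" for t
    unfolding a_def using Ck_on_Suc_has_vector_derivative[OF Ck_v] by blast
  have nz: "v t \<noteq> 0" for t using \<gamma> by (simp add: smooth_closed_immersed_def v_def)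
  define r where "r t = norm (v t)" for t
  have r: "r t > 0" "r t \<noteq> 0" for t using nz by (simp_all add: r_def)
  have r_cont: "continuous_on UNIV r"
    unfolding r_def by (intro continuous_intros v_cont)
  define \<tau> where "\<tau> = arc_deriv \<gamma> c"
  have \<tau>: "\<tau> t = v t /\<^sub>R r t" for t
    by (simp add: \<tau>_def arc_deriv_def r_def v_def velocity_def c_def)
  have \<tau>_cont: "continuous_on UNIV \<tau>"
    by (subst \<tau>[abs_def]) (intro continuous_intros v_cont r_cont, simp add: r)
  have unit: "norm (\<tau> t) = 1" for t using r(1)[of t] by (simp add: \<tau> r_def)
  have v_\<tau>: "v t = r t *\<^sub>R \<tau> t" for t using r(1)[of t] by (simp add: \<tau>)

  define \<tau>' where "\<tau>' t = inverse (r t) *\<^sub>R (a t - (a t \<bullet> \<tau> t) *\<^sub>R \<tau> t)" for t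
  have r': "(r has_real_derivative a t \<bullet> \<tau> t) (at t)" for t
  proof -
    have "(norm has_derivative (\<lambda>h. h \<bullet> sgn (v t))) (at (v t))"
      using nz by (rule has_derivative_norm)
    from has_derivative_compose[OF v'[unfolded has_vector_derivative_def] this]
    have "(r has_derivative (\<lambda>h. (h *\<^sub>R a t) \<bullet> sgn (v t))) (at t)"
      by (simp only: r_def[abs_def])
    also have "(\<lambda>h. (h *\<^sub>R a t) \<bullet> sgn (v t)) = (*) (a t \<bullet> \<tau> t)"
      by (simp add: fun_eq_iff \<tau> r_def sgn_div_norm)
    finally show ?thesis by (simp only: has_field_derivative_def)
  qed
  have \<tau>': "(\<tau> has_vector_derivative \<tau>' t) (at t)" for t
    unfolding \<tau>[abs_def] divideR_right
    by (rule has_vector_derivative_eq_rhs,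
        rule has_vector_derivative_scaleR[OF DERIV_inverse_fun[OF r'] v'])
       (use r[of t] in \<open>simp_all add: \<tau>'_def v_\<tau> algebra_simps\<close>)
  have \<tau>'_cont: "continuous_on UNIV \<tau>'"
    unfolding \<tau>'_def
    by (intro continuous_intros r_cont a_cont \<tau>_cont) (simp add: r)
  have orth: "\<tau>' t \<bullet> \<tau> t = 0" for t
    using unit[of t] by (simp add: \<tau>'_def inner_diff_left norm_eq_1)

  obtain \<sigma> where \<sigma>: "\<sigma> = 1 \<or> \<sigma> = - 1" and \<nu>_eq: "\<And>u. \<nu> (cis u) = \<sigma> *\<^sub>R (\<i> * \<tau> u)"
    using unit_normal_field_eq_rotated_tangent[OF \<gamma> \<nu> \<tau>_cont] v_\<tau> by (auto simp: v_def r_def)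
  have curv: "curvature \<gamma> \<nu> t = inverse (r t) * \<sigma> * (\<tau>' t \<bullet> (\<i> * \<tau> t))" for t
  proof -
    have "arc_deriv \<gamma> \<tau> t = \<tau>' t /\<^sub>R r t"
      by (simp add: arc_deriv_def vector_derivative_at[OF \<tau>'] r_def v_def)
    then show ?thesis
      by (simp add: curvature_def \<nu>_eq flip: \<tau>_def c_def)
  qed
  show thesis
  proof (rule that[of \<tau> \<sigma>])
    show "((\<lambda>t. \<gamma> (cis t)) has_vector_derivative norm (velocity \<gamma> u) *\<^sub>R \<tau> u) (at u)" for u
      using c'[of u] v_\<tau>[of u] by (simp add: c_def[abs_def] r_def v_def)
    show "(\<tau> has_vector_derivative (\<sigma> * curvature \<gamma> \<nu> u * norm (velocity \<gamma> u)) *\<^sub>R (\<i> * \<tau> u)) (at u)" for u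
    proof -
      have "\<tau>' u = (\<tau>' u \<bullet> (\<i> * \<tau> u)) *\<^sub>R (\<i> * \<tau> u)"
        using unit orth by (rule orthogonal_unit_decomposition)
      also have "\<tau>' u \<bullet> (\<i> * \<tau> u) = \<sigma> * curvature \<gamma> \<nu> u * norm (velocity \<gamma> u)"
        using \<sigma> r[of u] by (auto simp: curv r_def v_def)
      finally show ?thesis using \<tau>'[of u] by simp
    qed
    have "((\<lambda>t. c (t + 2 * pi)) has_vector_derivative v (2 * pi)) (at 0)"
    proof -
      have "((\<lambda>t. t + 2 * pi) has_derivative (\<lambda>t. t)) (at 0)"
        by (auto intro!: derivative_eq_intros)
      moreover have "(c has_derivative (\<lambda>x. x *\<^sub>R v (2 * pi))) (at (0 + 2 * pi))"
        using c'[of "2 * pi"] by (simp add: has_vector_derivative_def)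
      ultimately show ?thesis
        unfolding has_vector_derivative_def by (rule has_derivative_compose)
    qed
    also have "(\<lambda>t. c (t + 2 * pi)) = c" by (simp add: c_def flip: cis_mult)
    finally have "v (2 * pi) = v 0" using c' vector_derivative_unique_at by blast
    then show "\<tau> (2 * pi) = \<tau> 0" by (simp add: \<tau> r_def)
    show "continuous_on UNIV (\<lambda>u. norm (velocity \<gamma> u))"
      using r_cont by (simp add: r_def[abs_def] v_def)
    show "continuous_on UNIV (curvature \<gamma> \<nu>)"
      unfolding curv[abs_def]
      by (intro continuous_intros r_cont \<tau>_cont \<tau>'_cont) (simp add: r)
  qed (use unit \<sigma> in auto)
qed

section \<open>Curves with small oscillation of curvature\<close>

theorem corollary1p8:
  fixes \<gamma> \<nu> :: "complex \<Rightarrow> complex"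
  assumes "smooth_closed_immersed \<gamma>"
    and "unit_normal_field \<gamma> \<nu>"
    and "signed_area \<gamma> \<nu> > 0"
    and "arc_integral \<gamma> (curvature \<gamma> \<nu>) = 2 * pi"
    and "K_osc \<gamma> \<nu> < K_star"
    and "isoperimetric_ratio \<gamma> \<nu> < exp (K_star / (8 * pi\<^sup>2))"
  shows "diffeomorphic_to_round_circle \<gamma>"
proof -
  obtain \<tau> \<sigma> where frame:
    "\<And>u. ((\<lambda>t. \<gamma> (cis t)) has_vector_derivative norm (velocity \<gamma> u) *\<^sub>R \<tau> u) (at u)"
    "\<And>u. (\<tau> has_vector_derivative (\<sigma> * curvature \<gamma> \<nu> u * norm (velocity \<gamma> u)) *\<^sub>R (\<i> * \<tau> u)) (at u)"
    "\<And>u. norm (\<tau> u) = 1" "\<sigma> = 1 \<or> \<sigma> = - 1"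
    and closed: "\<tau> (2 * pi) = \<tau> 0"
    and cont: "continuous_on UNIV (\<lambda>u. norm (velocity \<gamma> u))" "continuous_on UNIV (curvature \<gamma> \<nu>)"
    using curve_frame[OF assms(1,2)] by blast
  have avg: "avg_curvature \<gamma> \<nu> = 2 * pi / curve_length \<gamma>"
    using assms(4) by (simp add: avg_curvature_def)
  have "inj_on (\<lambda>t. \<gamma> (cis t)) {0..<2 * pi}"
  proof (rule inj_on_if_turning_nearly_uniform[OF _ frame _ cont _ closed])
    show "0 < norm (velocity \<gamma> u)" for u
      using assms(1) by (simp add: smooth_closed_immersed_def)
    show "curve_length \<gamma> = integral {0..2 * pi} (\<lambda>u. norm (velocity \<gamma> u))"
      by (rule curve_length_def)
    show "curve_length \<gamma> * integral {0..2 * pi} (\<lambda>u. (curvature \<gamma> \<nu> u - 2 * pi / curve_length \<gamma>)\<^sup>2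
        * norm (velocity \<gamma> u)) < 1 / 4"
      using assms(5) K_star_less by (simp add: K_osc_def arc_integral_def avg)
  qed simp_all
  then show ?thesis
    by (intro embedded_curve_diffeomorphic_to_round_circle assms(1) inj_on_circle_if_inj_on_angle)
qed

end
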